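(* Let $n\ge3$ and let $m=x_1<x_2<\cdots<x_n=M$ be any $n$ distinct integers. Then $$m_4-m_2^2-\frac{m_3^2}{m_2}\le\frac{(M-m)^4}{64}-\beta_2,$$ where $$\beta_2=\begin{cases}\frac{1}{480}(n-2)(n-4)(4n^2-11n+2), & n\text{ even},\\[2pt] \frac{1}{480n}(n-1)(n-3)(4n^3-19n^2+32n-5), & n\text{ odd}.\end{cases}$$
   Context: $\bar x=\frac1n\sum_{i=1}^n x_i$ is the arithmetic mean and $m_s=\frac1n\sum_{i=1}^n(x_i-\bar x)^s$ is the $s$-th central moment (about the mean). *)

theory Defs
  imports Complex_Main
begin

definition arith_mean :: "nat \<Rightarrow> (nat \<Rightarrow> real) \<Rightarrow> real" where
  "arith_mean n x = (1 / real n) * (\<Sum>i=1..n. x i)"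

definition central_moment :: "nat \<Rightarrow> (nat \<Rightarrow> real) \<Rightarrow> nat \<Rightarrow> real" where
  "central_moment n x s = (1 / real n) * (\<Sum>i=1..n. (x i - arith_mean n x) ^ s)"

definition beta_2 :: "nat \<Rightarrow> real" where
  "beta_2 n =
    (if even n
     then 1 / 480 * (real n - 2) * (real n - 4) * (4 * real n ^ 2 - 11 * real n + 2)
     else 1 / (480 * real n) * (real n - 1) * (real n - 3)
            * (4 * real n ^ 3 - 19 * real n ^ 2 + 32 * real n - 5))"

end

theory Submission
  imports Defs
begin

text \<open>
  The quantity \<open>\<mu>\<^sub>4 - \<mu>\<^sub>2\<^sup>2 - \<mu>\<^sub>3\<^sup>2 / \<mu>\<^sub>2\<close> is the mean squared residual of the regression of
  \<open>x\<^sup>2\<close> on \<open>1\<close> and \<open>x\<close>, so it is at most the mean of \<open>(y\<^sup>2 - D\<^sup>2/8)\<^sup>2\<close>, where \<open>D = M - m\<close> and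
  \<open>y = x - (m + M)/2\<close>. Since \<open>(y\<^sup>2 - D\<^sup>2/8)\<^sup>2 = D\<^sup>4/64 - y\<^sup>2 (D\<^sup>2/4 - y\<^sup>2)\<close>, what is needed is a
  lower bound for the sum of \<open>y\<^sup>2 (D/2 - \<bar>y\<bar>) (D/2 + \<bar>y\<bar>)\<close>. On either side of the midpoint the
  \<open>x\<^sub>i\<close> are distinct integers, which bounds \<open>\<bar>y\<bar>\<close> and \<open>D/2 - \<bar>y\<bar>\<close> from below in terms of the
  position of \<open>x\<^sub>i\<close>. Summing, and balancing the numbers of points on the two sides by convexity,
  gives the bound \<open>(n + 1) choose 5\<close>, which is at least \<open>n \<beta>\<^sub>2\<close>.
\<close>

lemma sum_minus_arith_mean:
  assumes "n > 0"
  shows "(\<Sum>i=1..n. x i - arith_mean n x) = 0"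
  using assms by (simp add: sum_subtractf arith_mean_def)

lemma central_moment_2_pos:
  assumes "i \<in> {1..n}" "j \<in> {1..n}" "x i \<noteq> x j"
  shows "central_moment n x 2 > 0"
proof -
  let ?z = "\<lambda>i. (x i - arith_mean n x)\<^sup>2"
  have "sum ?z {1..n} \<noteq> 0"
  proof
    assume "sum ?z {1..n} = 0"
    then have "\<forall>k\<in>{1..n}. ?z k = 0"
      by (subst (asm) sum_nonneg_eq_0_iff) auto
    then show False using assms by auto
  qed
  moreover have "sum ?z {1..n} \<ge> 0" by (rule sum_nonneg) auto
  ultimately show ?thesis using assms(1) by (simp add: central_moment_def)
qed

text \<open>In the centred variable \<open>z\<close>, the polynomial on the right is
  \<open>z^2 + b * z + d\<close>, one competitor in the least-squares problem. Completing squares in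
  \<open>b\<close> and \<open>d\<close> exhibits its excess over the minimum.\<close>

lemma regression_residual_le:
  assumes "n > 0" and pos: "central_moment n x 2 > 0"
  shows "central_moment n x 4 - (central_moment n x 2)\<^sup>2
           - (central_moment n x 3)\<^sup>2 / central_moment n x 2
         \<le> (1 / real n) * (\<Sum>i=1..n. ((x i - c)\<^sup>2 - a)\<^sup>2)"
proof -
  define z where "z i = x i - arith_mean n x" for i
  define b where "b = 2 * (arith_mean n x - c)"
  define d where "d = (arith_mean n x - c)\<^sup>2 - a"
  let ?m = "central_moment n x"
  have m: "(\<Sum>i=1..n. z i ^ s) = real n * ?m s" for s
    using assms(1) by (simp add: central_moment_def z_def)
  have z1: "(\<Sum>i=1..n. z i) = 0"
    unfolding z_def using assms(1) by (rule sum_minus_arith_mean)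
  have "((x i - c)\<^sup>2 - a)\<^sup>2 = z i ^ 4 + 2 * b * z i ^ 3 + (b\<^sup>2 + 2 * d) * (z i)\<^sup>2
          + 2 * b * d * z i + d\<^sup>2" for i
    unfolding z_def b_def d_def by algebra
  then have "(\<Sum>i=1..n. ((x i - c)\<^sup>2 - a)\<^sup>2)
      = (\<Sum>i=1..n. z i ^ 4) + 2 * b * (\<Sum>i=1..n. z i ^ 3) + (b\<^sup>2 + 2 * d) * (\<Sum>i=1..n. (z i)\<^sup>2)
          + 2 * b * d * (\<Sum>i=1..n. z i) + real n * d\<^sup>2"
    by (simp add: sum.distrib sum_distrib_left)
  also have "\<dots> = real n * (?m 4 + 2 * b * ?m 3 + (b\<^sup>2 + 2 * d) * ?m 2 + d\<^sup>2)"
    unfolding m z1 by (simp add: algebra_simps)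
  finally have "(1 / real n) * (\<Sum>i=1..n. ((x i - c)\<^sup>2 - a)\<^sup>2)
      = ?m 4 + 2 * b * ?m 3 + (b\<^sup>2 + 2 * d) * ?m 2 + d\<^sup>2"
    using assms(1) by simp
  also have "\<dots> - (?m 4 - (?m 2)\<^sup>2 - (?m 3)\<^sup>2 / ?m 2)
      = (b * ?m 2 + ?m 3)\<^sup>2 / ?m 2 + (d + ?m 2)\<^sup>2"
    using pos by (simp add: field_simps power2_eq_square)
  moreover have "\<dots> \<ge> 0" using pos by simp
  ultimately show ?thesis by linarith
qed

text \<open>The right-hand side is \<open>8 * ((L + 2) choose 5)\<close> with \<open>L = 2 * N - 2 + r\<close>, the value
  attained by \<open>w k = r + 2 * k\<close> and \<open>D = L\<close>.\<close>

lemma sum_spaced_lower_bound: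
  fixes w :: "nat \<Rightarrow> real" and r D :: real
  assumes r: "r = 0 \<or> r = 1 \<or> r = 2"
    and lo: "\<And>k. k < N \<Longrightarrow> r + 2 * real k \<le> w k"
    and hi: "\<And>k. k < N \<Longrightarrow> w k + 2 * (real N - 1 - real k) \<le> D"
    and L: "L = 2 * real N - 2 + r"
  shows "(L ^ 5 - 5 * L ^ 3 + 4 * L) / 15 \<le> (\<Sum>k<N. (w k)\<^sup>2 * (D\<^sup>2 - (w k)\<^sup>2))"
proof -
  have closed: "(\<Sum>k<K. (r + 2 * real k)\<^sup>2 * (P - (r + 2 * real k)\<^sup>2)) =
      (\<lambda>t. P * (r\<^sup>2 * t + 2 * r * t * (t - 1) + 2 * t * (t - 1) * (2 * t - 1) / 3)
        - (r ^ 4 * t + 4 * r ^ 3 * t * (t - 1) + 4 * r\<^sup>2 * t * (t - 1) * (2 * t - 1)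
           + 8 * r * t\<^sup>2 * (t - 1)\<^sup>2
           + 8 * t * (t - 1) * (2 * t - 1) * (3 * t\<^sup>2 - 3 * t - 1) / 15)) (real K)"
    for K :: nat and P :: real
    by (induction K) (simp_all add: field_simps power2_eq_square power3_eq_cube power4_eq_xxxx)
  \<comment> \<open>An identity special to \<open>r\<close> = 0, 1, 2: for \<open>N = 1\<close> the
    left side is \<open>r * (r^2 - 1) * (r^2 - 4) / 15\<close>, the right side 0.\<close>
  have "(L ^ 5 - 5 * L ^ 3 + 4 * L) / 15
      = (\<Sum>k<N. (r + 2 * real k)\<^sup>2 * (L\<^sup>2 - (r + 2 * real k)\<^sup>2))"
    using r unfolding closed L
    by (elim disjE) (simp_all add: field_simps power_numeral_reduce)
  also have "\<dots> \<le> (\<Sum>k<N. (w k)\<^sup>2 * (D\<^sup>2 - (w k)\<^sup>2))"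
  proof (rule sum_mono)
    fix k assume "k \<in> {..<N}"
    then have k: "k < N" by simp
    define t where "t = r + 2 * real k"
    define d where "d = 2 * (real N - 1 - real k)"
    have t: "0 \<le> t" "t \<le> w k" using r lo[OF k] by (auto simp: t_def)
    have d: "0 \<le> d" "w k + d \<le> D" using k hi[OF k] by (auto simp: d_def)
    \<comment> \<open>Here \<open>d = L - t\<close> and \<open>d + 2 * t = L + t\<close>; each
      factor is dominated separately, the second since \<open>D + w k\<close> \<ge>
      \<open>d + 2 * w k\<close>.\<close>
    have eq: "L\<^sup>2 - t\<^sup>2 = d * (d + 2 * t)" unfolding L t_def d_def by algebra
    also have "\<dots> \<le> (D - w k) * (D + w k)"
      using t d by (intro mult_mono) simp_all
    also have "\<dots> = D\<^sup>2 - (w k)\<^sup>2" by algebra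
    finally have "L\<^sup>2 - t\<^sup>2 \<le> D\<^sup>2 - (w k)\<^sup>2" .
    moreover have "0 \<le> L\<^sup>2 - t\<^sup>2" unfolding eq using t d by simp
    moreover have "t\<^sup>2 \<le> (w k)\<^sup>2" using t by (intro power_mono)
    ultimately show "(r + 2 * real k)\<^sup>2 * (L\<^sup>2 - (r + 2 * real k)\<^sup>2) \<le> (w k)\<^sup>2 * (D\<^sup>2 - (w k)\<^sup>2)"
      unfolding t_def by (intro mult_mono) auto
  qed
  finally show ?thesis .
qed

text \<open>The quintic is not convex near 0, its second derivative being
  \<open>10 * L * (2 * L^2 - 3)\<close>. A midpoint \<open>W\<close> \<ge> 2 still makes the excess
  nonnegative for every offset \<open>e\<close>.\<close>

lemma quintic_midpoint_le:
  fixes L L' W :: real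
  assumes "L + L' = 2 * W" "W \<ge> 2"
  shows "2 * (W ^ 5 - 5 * W ^ 3 + 4 * W)
         \<le> (L ^ 5 - 5 * L ^ 3 + 4 * L) + (L' ^ 5 - 5 * L' ^ 3 + 4 * L')"
proof -
  define e where "e = L - W"
  have L: "L = W + e" "L' = W - e" using assms(1) by (auto simp: e_def)
  have "(L ^ 5 - 5 * L ^ 3 + 4 * L) + (L' ^ 5 - 5 * L' ^ 3 + 4 * L')
      - 2 * (W ^ 5 - 5 * W ^ 3 + 4 * W) = 10 * W * e\<^sup>2 * (2 * W\<^sup>2 - 3) + 10 * W * e ^ 4"
    unfolding L by algebra
  moreover have "2 * W\<^sup>2 - 3 \<ge> 0" using power_mono[OF assms(2), of 2] by simp
  ultimately show ?thesis using assms(2) by (smt (verit) mult_nonneg_nonneg zero_le_power2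
        zero_le_even_power even_numeral)
qed

lemma strict_mono_on_int_gap:
  fixes x :: "nat \<Rightarrow> int"
  assumes "strict_mono_on {1..n} x" "1 \<le> i" "i \<le> j" "j \<le> n"
  shows "x i + int (j - i) \<le> x j"
  using assms(3,4)
proof (induction j rule: dec_induct)
  case (step j)
  have "x j < x (Suc j)"
    using assms(1,2) step by (auto simp: strict_mono_on_def)
  then show ?case using step by (simp add: Suc_diff_le)
qed simp

text \<open>Doubling the deviations from the midpoint keeps them integral. They all have the parity
  of \<open>D\<close>, so consecutive ones differ by at least 2.\<close>

lemma sum_central_quartic_ge:
  fixes x :: "nat \<Rightarrow> int"
  assumes n: "n \<ge> 3" and mono: "strict_mono_on {1..n} x"
  defines "w \<equiv> \<lambda>i. real_of_int (2 * x i - x 1 - x n)"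
    and "D \<equiv> real_of_int (x n - x 1)"
    and "W \<equiv> real n - 1"
  shows "2 * (W ^ 5 - 5 * W ^ 3 + 4 * W) / 15 \<le> (\<Sum>i=1..n. (w i)\<^sup>2 * (D\<^sup>2 - (w i)\<^sup>2))"
proof -
  note gap = strict_mono_on_int_gap[OF mono]
  let ?S = "{i \<in> {1..n}. 2 * x i < x 1 + x n}"
  define q where "q = Max ?S"
  have "1 \<in> ?S" using gap[of 1 n] n by simp
  then have qS: "q \<in> ?S" unfolding q_def by (intro Max_in) auto
  then have q: "1 \<le> q" "q \<le> n" "2 * x q < x 1 + x n" by auto
  have upper: "2 * x i \<ge> x 1 + x n" if "q < i" "i \<le> n" for i
  proof (rule ccontr)
    assume "\<not> ?thesis"
    then have "i \<in> ?S" using that by auto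
    then have "i \<le> q" unfolding q_def by (intro Max_ge) auto
    then show False using that by simp
  qed
  define p where "p = n - q"
  \<comment> \<open>Smallest possible \<open>w i\<close> on the right, where the midpoint itself is
    counted. On the left \<open>w i\<close> is strictly negative, so its least absolute value is
    \<open>2 - r\<close>: 1 for odd \<open>D\<close>, 2 for even \<open>D\<close>.\<close>
  define r :: int where "r = (x n - x 1) mod 2"
  have r: "r = 0 \<or> r = 1" unfolding r_def by auto
  let ?h = "\<lambda>i. (w i)\<^sup>2 * (D\<^sup>2 - (w i)\<^sup>2)"
  let ?T = "\<lambda>L::real. L ^ 5 - 5 * L ^ 3 + 4 * L"
  define L where "L = 2 * real p - 2 + real_of_int r"
  define L' where "L' = 2 * real q - 2 + real_of_int (2 - r)"
  have "?T L / 15 \<le> (\<Sum>k<p. ?h (Suc (q + k)))"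
  proof (rule sum_spaced_lower_bound)
    show "real_of_int r = 0 \<or> real_of_int r = 1 \<or> real_of_int r = 2" using r by auto
    show "real_of_int r + 2 * real k \<le> w (Suc (q + k))" if "k < p" for k
    proof -
      have "r \<le> 2 * x (Suc q) - x 1 - x n"
        using upper[of "Suc q"] that unfolding p_def r_def by presburger
      moreover have "x (Suc q) + int k \<le> x (Suc (q + k))"
        using gap[of "Suc q" "Suc (q + k)"] that unfolding p_def by simp
      ultimately show ?thesis unfolding w_def by linarith
    qed
    show "w (Suc (q + k)) + 2 * (real p - 1 - real k) \<le> D" if "k < p" for k
    proof -
      have le: "Suc (q + k) \<le> n" using that by (simp add: p_def)
      show ?thesis using gap[OF _ le order_refl] le by (simp add: w_def D_def p_def)
    qed
  qed (rule L_def)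
  \<comment> \<open>The left half is read outward from the midpoint, with signs flipped.\<close>
  moreover have "?T L' / 15 \<le> (\<Sum>k<q. (- w (q - k))\<^sup>2 * (D\<^sup>2 - (- w (q - k))\<^sup>2))"
  proof (rule sum_spaced_lower_bound)
    show "real_of_int (2 - r) = 0 \<or> real_of_int (2 - r) = 1 \<or> real_of_int (2 - r) = 2"
      using r by auto
    show "real_of_int (2 - r) + 2 * real k \<le> - w (q - k)" if "k < q" for k
    proof -
      have "2 - r \<le> x 1 + x n - 2 * x q"
        using q(3) unfolding r_def by presburger
      moreover have "x (q - k) + int k \<le> x q"
        using gap[of "q - k" q] that q by simp
      ultimately show ?thesis unfolding w_def by linarith
    qed
    show "- w (q - k) + 2 * (real q - 1 - real k) \<le> D" if "k < q" for k
    proof -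
      have "1 \<le> q - k" "q - k \<le> n" using that q(2) by auto
      then show ?thesis using gap[of 1 "q - k"] that by (simp add: w_def D_def)
    qed
  qed (rule L'_def)
  moreover have "(\<Sum>k<q. ?h (q - k)) + (\<Sum>k<p. ?h (Suc (q + k))) = sum ?h {1..n}"
  proof -
    have "(\<Sum>k<q. ?h (q - k)) = (\<Sum>i<q. ?h (Suc i))"
      using sum.nat_diff_reindex[of "\<lambda>i. ?h (Suc i)" q] by (simp add: Suc_diff_Suc)
    moreover have "(\<Sum>i<q + p. ?h (Suc i)) = (\<Sum>i<q. ?h (Suc i)) + (\<Sum>k<p. ?h (Suc (q + k)))"
      by (induction p) auto
    moreover have "q + p = n" using q by (simp add: p_def)
    moreover have "sum ?h {1..n} = (\<Sum>i<n. ?h (Suc i))"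
      using sum.atLeast1_atMost_eq[of ?h n] by simp
    ultimately show ?thesis by simp
  qed
  \<comment> \<open>\<open>r\<close> cancels in \<open>L + L' = 2 * (p + q) - 2 = 2 * W\<close>, so
    the bound depends on neither parity nor split.\<close>
  moreover have "2 * ?T W \<le> ?T L + ?T L'"
    using q n by (intro quintic_midpoint_le) (auto simp: L_def L'_def W_def p_def)
  ultimately show ?thesis by simp
qed

lemma beta_2_le:
  assumes n: "n \<ge> 3" and W: "W = real n - 1"
  shows "real n * beta_2 n \<le> (W ^ 5 - 5 * W ^ 3 + 4 * W) / 120"
proof -
  have n3: "real n \<ge> 3" using n by simp
  have T: "W ^ 5 - 5 * W ^ 3 + 4 * W
      = (real n + 1) * real n * (real n - 1) * (real n - 2) * (real n - 3)"
    unfolding W by algebra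
  show ?thesis
  proof (cases "even n")
    case True
    have "(W ^ 5 - 5 * W ^ 3 + 4 * W) / 120 - real n * beta_2 n
        = real n * (real n - 2) * (5 * (3 * real n * (real n - 4) + 2 * real n + 4)) / 480"
      unfolding T using True by (simp add: beta_2_def field_simps power2_eq_square power3_eq_cube)
    \<comment> \<open>Evenness excludes \<open>n = 3\<close>, making \<open>n * (n - 4)\<close>
      nonnegative.\<close>
    moreover have "n \<ge> 4" using True n by presburger
    then have "real n \<ge> 4" by simp
    ultimately show ?thesis by (smt (verit) divide_nonneg_pos mult_nonneg_nonneg)
  next
    case False
    have "(W ^ 5 - 5 * W ^ 3 + 4 * W) / 120 - real n * beta_2 n
        = (real n - 1) * (real n - 3) * (5 * (3 * real n * (real n - 3) + real n + 1)) / 480"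
      unfolding T using False n by (simp add: beta_2_def field_simps power2_eq_square power3_eq_cube)
    moreover have "\<dots> \<ge> 0" using n3 by simp
    ultimately show ?thesis by linarith
  qed
qed

theorem corollary2p12:
  fixes n :: nat and x :: "nat \<Rightarrow> int" and m M :: int
    and mu :: "nat \<Rightarrow> real"
  assumes "n \<ge> 3"
    and "strict_mono_on {1..n} x"
    and "m = x 1"
    and "M = x n"
  defines "mu \<equiv> central_moment n (\<lambda>i. real_of_int (x i))"
  shows "mu 4 - (mu 2)\<^sup>2 - (mu 3)\<^sup>2 / mu 2
           \<le> (real_of_int (M - m)) ^ 4 / 64 - beta_2 n"
proof -
  define D where "D = real_of_int (M - m)"
  define W where "W = real n - 1"
  define w where "w i = real_of_int (2 * x i - m - M)" for i
  define c where "c = real_of_int (m + M) / 2"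
  have n: "n > 0" using assms(1) by simp
  have "x 1 < x n" using assms(1,2) by (auto simp: strict_mono_on_def)
  then have "mu 2 > 0"
    unfolding mu_def using n by (intro central_moment_2_pos[of 1 n n]) auto
  \<comment> \<open>With \<open>a = D^2 / 8\<close> the squared residual equals
    \<open>D^4 / 64\<close> at the midpoint and at both endpoints, its maximum over the
    range.\<close>
  then have "mu 4 - (mu 2)\<^sup>2 - (mu 3)\<^sup>2 / mu 2
      \<le> (1 / real n) * (\<Sum>i=1..n. ((real_of_int (x i) - c)\<^sup>2 - D\<^sup>2 / 8)\<^sup>2)"
    unfolding mu_def using n by (intro regression_residual_le)
  also have "(\<Sum>i=1..n. ((real_of_int (x i) - c)\<^sup>2 - D\<^sup>2 / 8)\<^sup>2)
      = (\<Sum>i=1..n. D ^ 4 / 64 - (w i)\<^sup>2 * (D\<^sup>2 - (w i)\<^sup>2) / 16)"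
  proof (rule sum.cong)
    fix i
    have y: "real_of_int (x i) - c = w i / 2" by (simp add: w_def c_def field_simps)
    show "((real_of_int (x i) - c)\<^sup>2 - D\<^sup>2 / 8)\<^sup>2 = D ^ 4 / 64 - (w i)\<^sup>2 * (D\<^sup>2 - (w i)\<^sup>2) / 16"
      unfolding y by (simp add: field_simps power2_eq_square power4_eq_xxxx)
  qed simp
  also have "\<dots> = real n * D ^ 4 / 64 - (\<Sum>i=1..n. (w i)\<^sup>2 * (D\<^sup>2 - (w i)\<^sup>2)) / 16"
    by (simp add: sum_subtractf sum_divide_distrib)
  \<comment> \<open>The constants match: 2/15 from the quartic sum, divided by 16, is the 1/120 of
    \<open>beta_2_le\<close>.\<close>
  also have "(1 / real n) * \<dots> \<le> (1 / real n) * (real n * D ^ 4 / 64 - real n * beta_2 n)"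
    using sum_central_quartic_ge[OF assms(1,2)] beta_2_le[OF assms(1) W_def]
    by (intro mult_left_mono) (simp_all add: w_def D_def W_def assms(3,4))
  also have "\<dots> = D ^ 4 / 64 - beta_2 n" using n by (simp add: field_simps)
  finally show ?thesis unfolding D_def .
qed

end
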